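(* Let $K$ be any non-empty compact convex subset of a locally convex real space $\mathcal{X}$ and let $h:K\rightarrow[\mathrm{k},\infty]$ be any extended real-valued function, with $\mathrm{k}\in\mathbb{R}$. Then: (i) $\inf h(K)=\inf \Gamma(h)(K)$. (ii) The set $M$ of minimizers of $\Gamma(h)$ over $K$ equals the closed convex hull of the set $\Omega(h,K)$, i.e. $$M=\overline{\mathrm{co}}\left(\Omega(h,K)\right).$$
   Context: Topological vector spaces are assumed to be Hausdorff; a locally convex real space is a real, Hausdorff, locally convex topological vector space. For a set $K$ and $h:K\to(-\infty,\infty]$, $\inf h(K):=\inf_{x\in K}h(x)$. The set of limit points of approximating minimizers of $h$ is $$\Omega(h,K):=\Big\{x\in K:\ \exists \text{ a net } \{x_i\}_{i\in I}\subset K \text{ with } x_i\to x \text{ and } \lim_I h(x_i)=\inf h(K)\Big\}.$$ Let $\mathrm{A}(\mathcal{X})$ be the space of all affine continuous real-valued functions on $\mathcal{X}$. The $\Gamma$-regularization of $h$ on $K$ is the function defined, for all $x\in K$, by $$\Gamma(h)(x):=\sup\{m(x): m\in \mathrm{A}(\mathcal{X}) \text{ and } m|_K\leq h\}.$$ $\overline{\mathrm{co}}(S)$ denotes the closure of the convex hull of $S$. *)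

theory Defs
  imports "HOL-Analysis.Analysis"
begin

section \<open>Locally convex real spaces\<close>

class topological_real_vector = real_vector + topological_ab_group_add +
  assumes tendsto_scaleR_Pair: "LIM z (nhds a \<times>\<^sub>F nhds x). fst z *\<^sub>R snd z :> nhds (a *\<^sub>R x)"

class locally_convex_real_space = topological_real_vector + t2_space +
  \<comment> \<open>\<open>convex\<close> cannot occur in a class axiom and is unfolded here; see \<open>convex_nhd_0\<close>\<close>
  assumes convex_nhd_0_raw: "open U \<Longrightarrow> 0 \<in> U \<Longrightarrow> \<exists>V. open V \<and>
    (\<forall>x\<in>V. \<forall>y\<in>V. \<forall>u\<ge>0. \<forall>v\<ge>0. u + v = 1 \<longrightarrow> u *\<^sub>R x + v *\<^sub>R y \<in> V) \<and> 0 \<in> V \<and> V \<subseteq> U"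

lemma convex_nhd_0:
  fixes U :: "'a::locally_convex_real_space set"
  assumes "open U" "0 \<in> U"
  shows "\<exists>V. open V \<and> convex V \<and> 0 \<in> V \<and> V \<subseteq> U"
  using convex_nhd_0_raw[OF assms] unfolding convex_def .

instance real_normed_vector \<subseteq> locally_convex_real_space
proof
  fix a :: real and x :: 'a
  have "((\<lambda>z. fst z *\<^sub>R snd z) \<longlongrightarrow> a *\<^sub>R x) (nhds a \<times>\<^sub>F nhds x)"
    by (intro tendsto_scaleR filterlim_fst filterlim_snd)
  then show "LIM z (nhds a \<times>\<^sub>F nhds x). fst z *\<^sub>R snd z :> nhds (a *\<^sub>R x)" .
next
  fix U :: "'a set"
  assume "open U" "0 \<in> U"
  then obtain e where "e > 0" "ball 0 e \<subseteq> U"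
    using open_contains_ball by blast
  then show "\<exists>V. open V \<and>
    (\<forall>x\<in>V. \<forall>y\<in>V. \<forall>u\<ge>0. \<forall>v\<ge>0. u + v = 1 \<longrightarrow> u *\<^sub>R x + v *\<^sub>R y \<in> V) \<and> 0 \<in> V \<and> V \<subseteq> U"
    using convex_ball[of 0 e] unfolding convex_def by (intro exI[of _ "ball 0 e"]) auto
qed


section \<open>Nets\<close>

definition directed_set :: "'i set \<Rightarrow> ('i \<Rightarrow> 'i \<Rightarrow> bool) \<Rightarrow> bool"
  where "directed_set I r \<longleftrightarrow> I \<noteq> {} \<and> (\<forall>i\<in>I. r i i) \<and>
    (\<forall>i\<in>I. \<forall>j\<in>I. \<forall>l\<in>I. r i j \<longrightarrow> r j l \<longrightarrow> r i l) \<and>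
    (\<forall>i\<in>I. \<forall>j\<in>I. \<exists>l\<in>I. r i l \<and> r j l)"

definition net_converges ::
    "'i set \<Rightarrow> ('i \<Rightarrow> 'i \<Rightarrow> bool) \<Rightarrow> ('i \<Rightarrow> 'a::topological_space) \<Rightarrow> 'a \<Rightarrow> bool"
  where "net_converges I r \<xi> x \<longleftrightarrow>
    (\<forall>U. open U \<longrightarrow> x \<in> U \<longrightarrow> (\<exists>i\<in>I. \<forall>j\<in>I. r i j \<longrightarrow> \<xi> j \<in> U))"


section \<open>Limit points of approximating minimizers\<close>

text \<open>HOL cannot quantify over the type of the index set inside a definition, so the index set is
  taken to consist of subsets of the space. By \<open>Omega_netI\<close> below, nets over an index
  set of any type give no further points, hence this is no restriction.\<close>

definition Omega :: "('a::topological_space \<Rightarrow> ereal) \<Rightarrow> 'a set \<Rightarrow> 'a set"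
  where "Omega h K = {x \<in> K. \<exists>(I :: 'a set set) r \<xi>. directed_set I r \<and> \<xi> ` I \<subseteq> K \<and>
    net_converges I r \<xi> x \<and> net_converges I r (h \<circ> \<xi>) (INF y\<in>K. h y)}"

lemma net_imp_dense:
  assumes "directed_set I r" "\<xi> ` I \<subseteq> K" "net_converges I r \<xi> x" "net_converges I r (h \<circ> \<xi>) c"
    and "open U" "x \<in> U" "open V" "c \<in> V"
  shows "\<exists>y\<in>K. y \<in> U \<and> h y \<in> V"
proof -
  obtain i where i: "i \<in> I" "\<forall>j\<in>I. r i j \<longrightarrow> \<xi> j \<in> U"
    using assms unfolding net_converges_def by blast
  obtain j where j: "j \<in> I" "\<forall>l\<in>I. r j l \<longrightarrow> (h \<circ> \<xi>) l \<in> V"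
    using assms unfolding net_converges_def by blast
  obtain l where "l \<in> I" "r i l" "r j l"
    using assms(1) i(1) j(1) unfolding directed_set_def by blast
  then show ?thesis
    using i j assms(2) by (intro bexI[of _ "\<xi> l"]) auto
qed

lemma Omega_iff_dense:
  "x \<in> Omega h K \<longleftrightarrow> x \<in> K \<and>
    (\<forall>U V. open U \<longrightarrow> x \<in> U \<longrightarrow> open V \<longrightarrow> (INF y\<in>K. h y) \<in> V \<longrightarrow> (\<exists>y\<in>K. y \<in> U \<and> h y \<in> V))"
  (is "_ \<longleftrightarrow> _ \<and> ?D")
proof
  assume "x \<in> Omega h K"
  then obtain I :: "'a set set" and r \<xi> where "x \<in> K" "directed_set I r" "\<xi> ` I \<subseteq> K"
    "net_converges I r \<xi> x" "net_converges I r (h \<circ> \<xi>) (INF y\<in>K. h y)"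
    unfolding Omega_def by blast
  then show "x \<in> K \<and> ?D"
    using net_imp_dense[of I r \<xi> K x h] by blast
next
  let ?c = "INF y\<in>K. h y"
  assume *: "x \<in> K \<and> ?D"
  define B where "B U V = {y \<in> K. y \<in> U \<and> h y \<in> V}" for U V
  define I where "I = {B U V | U V. open U \<and> x \<in> U \<and> open V \<and> ?c \<in> V}"
  define r :: "'a set \<Rightarrow> 'a set \<Rightarrow> bool" where "r S T \<longleftrightarrow> T \<subseteq> S" for S T
  define \<xi> where "\<xi> S = (SOME y. y \<in> S)" for S :: "'a set"
  have xi: "\<xi> S \<in> S" if "S \<in> I" for S
  proof -
    from that * have "\<exists>y. y \<in> S"
      unfolding I_def B_def by blast
    then show ?thesis
      unfolding \<xi>_def by (rule someI_ex)
  qed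
  have BI: "B U V \<in> I" if "open U" "x \<in> U" "open V" "?c \<in> V" for U V
    using that unfolding I_def by blast
  have "directed_set I r"
    unfolding directed_set_def
  proof (intro conjI ballI)
    show "I \<noteq> {}"
      using BI[of UNIV UNIV] by auto
    fix S T assume "S \<in> I" "T \<in> I"
    then obtain U V U' V' where UV:
      "S = B U V" "open U" "x \<in> U" "open V" "?c \<in> V"
      "T = B U' V'" "open U'" "x \<in> U'" "open V'" "?c \<in> V'"
      unfolding I_def by blast
    have "B (U \<inter> U') (V \<inter> V') \<in> I"
      using UV by (intro BI) auto
    moreover have "r S (B (U \<inter> U') (V \<inter> V'))" "r T (B (U \<inter> U') (V \<inter> V'))"
      unfolding UV(1,6) by (auto simp: r_def B_def)
    ultimately show "\<exists>L\<in>I. r S L \<and> r T L"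
      by blast
  qed (auto simp: r_def)
  moreover have "\<xi> ` I \<subseteq> K"
    using xi unfolding I_def B_def by blast
  moreover have "net_converges I r \<xi> x"
    unfolding net_converges_def
  proof (intro allI impI)
    fix U assume "open U" "x \<in> U"
    then show "\<exists>i\<in>I. \<forall>j\<in>I. r i j \<longrightarrow> \<xi> j \<in> U"
      using BI[of U UNIV] xi by (intro bexI[of _ "B U UNIV"]) (auto simp: r_def B_def)
  qed
  moreover have "net_converges I r (h \<circ> \<xi>) ?c"
    unfolding net_converges_def
  proof (intro allI impI)
    fix V assume "open V" "?c \<in> V"
    then show "\<exists>i\<in>I. \<forall>j\<in>I. r i j \<longrightarrow> (h \<circ> \<xi>) j \<in> V"
      using BI[of UNIV V] xi by (intro bexI[of _ "B UNIV V"]) (auto simp: r_def B_def)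
  qed
  ultimately show "x \<in> Omega h K"
    using * unfolding Omega_def by blast
qed

lemma Omega_netI:
  fixes I :: "'i set"
  assumes "x \<in> K" "directed_set I r" "\<xi> ` I \<subseteq> K"
    "net_converges I r \<xi> x" "net_converges I r (h \<circ> \<xi>) (INF y\<in>K. h y)"
  shows "x \<in> Omega h K"
  using assms net_imp_dense[OF assms(2-5)] unfolding Omega_iff_dense by blast


section \<open>\<open>\<Gamma>\<close>-regularization\<close>

definition affine_fun :: "('a::real_vector \<Rightarrow> real) \<Rightarrow> bool"
  where "affine_fun m \<longleftrightarrow>
    (\<forall>x y u v. u + v = 1 \<longrightarrow> m (u *\<^sub>R x + v *\<^sub>R y) = u * m x + v * m y)"

definition affine_continuous :: "('a::topological_real_vector \<Rightarrow> real) set"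
  where "affine_continuous = {m. affine_fun m \<and> continuous_on UNIV m}"

definition Gamma_reg ::
    "'a::topological_real_vector set \<Rightarrow> ('a \<Rightarrow> ereal) \<Rightarrow> 'a \<Rightarrow> ereal"
  where "Gamma_reg K h x =
    (SUP m \<in> {m \<in> affine_continuous. \<forall>y\<in>K. ereal (m y) \<le> h y}. ereal (m x))"

definition minimizers :: "('a \<Rightarrow> ereal) \<Rightarrow> 'a set \<Rightarrow> 'a set"
  where "minimizers f K = {x \<in> K. \<forall>y\<in>K. f x \<le> f y}"

end

theory Submission
  imports Defs
begin

text \<open>With \<open>c = inf h(K)\<close>, the constant \<open>c\<close> is an admissible affine minorant, so
  \<open>inf \<Gamma>(h)(K) = c\<close> and the minimizers of \<open>\<Gamma>(h)\<close> are the points of \<open>K\<close> at which no affine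
  minorant of \<open>h\<close> exceeds \<open>c\<close>; this is a closed convex set containing \<open>\<Omega>(h,K)\<close>.
  Conversely, a point of \<open>K\<close> off the closed convex hull of \<open>\<Omega>(h,K)\<close> is strictly separated from it by
  some \<open>f > a\<close>. As \<open>K \<inter> {f \<ge> a}\<close> is compact and misses \<open>\<Omega>(h,K)\<close>, there \<open>h \<ge> c + \<delta>\<close> for
  some \<open>\<delta> > 0\<close>, so \<open>c + \<epsilon> (f - a)\<close> is for small \<open>\<epsilon> > 0\<close> a minorant exceeding \<open>c\<close> at the point.
  The separation theorem is obtained from the fact that minimal sublinear functionals are linear.\<close>

section \<open>Sublinear functionals\<close>

definition sublinear :: "('a::real_vector \<Rightarrow> real) \<Rightarrow> bool"
  where "sublinear p \<longleftrightarrow> (\<forall>x y. p (x + y) \<le> p x + p y) \<and> (\<forall>t\<ge>0. \<forall>x. p (t *\<^sub>R x) = t * p x)"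

lemma sublinear_add: "sublinear p \<Longrightarrow> p (x + y) \<le> p x + p y"
  and sublinear_scaleR: "sublinear p \<Longrightarrow> 0 \<le> t \<Longrightarrow> p (t *\<^sub>R x) = t * p x"
  by (auto simp: sublinear_def)

lemma sublinear_0: "sublinear p \<Longrightarrow> p 0 = 0"
  using sublinear_scaleR[of p 0 0] by simp

lemma sublinear_ge_minus: "sublinear p \<Longrightarrow> - p (- x) \<le> p x"
  using sublinear_add[of p x "- x"] sublinear_0[of p] by simp

text \<open>Homogeneity follows from one inequality for positive scalars: applied to
  \<open>inverse t\<close> and \<open>t *\<^sub>R x\<close>, it yields the reverse one.\<close>

lemma sublinearI:
  assumes add: "\<And>x y. p (x + y) \<le> p x + p y" and zero: "p 0 = 0"
    and scale: "\<And>t x. 0 < t \<Longrightarrow> p (t *\<^sub>R x) \<le> t * p x"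
  shows "sublinear p"
  unfolding sublinear_def
proof (intro conjI allI impI add)
  fix t :: real and x assume "0 \<le> t"
  show "p (t *\<^sub>R x) = t * p x"
  proof (cases "t = 0")
    case True
    then show ?thesis by (simp add: zero)
  next
    case False
    with \<open>0 \<le> t\<close> have t: "0 < t" by simp
    have "p x \<le> inverse t * p (t *\<^sub>R x)"
      using scale[of "inverse t" "t *\<^sub>R x"] t by simp
    then have "t * p x \<le> p (t *\<^sub>R x)"
      using t by (simp add: field_simps)
    with scale[OF t, of x] show ?thesis by simp
  qed
qed

text \<open>Lowering \<open>p\<close> as far as possible in the direction \<open>-y\<close>: the largest sublinear minorant
  with value \<open>- p y\<close> at \<open>- y\<close>.\<close>

lemma sublinear_lower:
  fixes p :: "'a::real_vector \<Rightarrow> real"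
  assumes p: "sublinear p"
  obtains q where "sublinear q" "\<And>x t. 0 \<le> t \<Longrightarrow> q x \<le> p (x + t *\<^sub>R y) - t * p y"
proof
  define q where "q x = (INF t\<in>{0..}. p (x + t *\<^sub>R y) - t * p y)" for x
  \<comment> \<open>A bound independent of \<open>t\<close>, so that the real infimum defining
    \<open>q\<close> is a genuine one.\<close>
  have lb: "- p (- x) \<le> p (x + t *\<^sub>R y) - t * p y" if "0 \<le> t" for x t
    using sublinear_add[OF p, of "x + t *\<^sub>R y" "- x"] sublinear_scaleR[OF p that, of y] by simp
  have bdd: "bdd_below ((\<lambda>t. p (x + t *\<^sub>R y) - t * p y) ` {0..})" for x
    using lb by (intro bdd_belowI[of _ "- p (- x)"]) auto
  show upper: "q x \<le> p (x + t *\<^sub>R y) - t * p y" if "0 \<le> t" for x t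
    unfolding q_def using that by (intro cINF_lower bdd) auto
  have greatest: "b \<le> q x" if "\<And>t. 0 \<le> t \<Longrightarrow> b \<le> p (x + t *\<^sub>R y) - t * p y" for b x
    unfolding q_def using that by (intro cINF_greatest) auto
  show "sublinear q"
  proof (rule sublinearI)
    fix u v
    \<comment> \<open>The shifts \<open>s\<close> and \<open>t\<close> for the two summands add up
      to an admissible shift for \<open>u + v\<close>; the infima over \<open>s\<close> and
      \<open>t\<close> are then taken one after the other.\<close>
    have *: "q (u + v) - (p (v + t *\<^sub>R y) - t * p y) \<le> p (u + s *\<^sub>R y) - s * p y"
      if "0 \<le> s" "0 \<le> t" for s t
      using upper[of "s + t" "u + v"] that
        sublinear_add[OF p, of "u + s *\<^sub>R y" "v + t *\<^sub>R y"] by (simp add: algebra_simps)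
    have "q (u + v) - q u \<le> q v"
    proof (rule greatest)
      fix t :: real assume "0 \<le> t"
      then have "q (u + v) - (p (v + t *\<^sub>R y) - t * p y) \<le> q u"
        by (intro greatest *)
      then show "q (u + v) - q u \<le> p (v + t *\<^sub>R y) - t * p y" by simp
    qed
    then show "q (u + v) \<le> q u + q v" by simp
  next
    show "q 0 = 0"
      using upper[of 0 0] greatest[of 0 0] sublinear_0[OF p] by (simp add: sublinear_scaleR[OF p])
  next
    fix s :: real and x assume s: "0 < s"
    have "inverse s * q (s *\<^sub>R x) \<le> q x"
    proof (rule greatest)
      fix t :: real assume "0 \<le> t"
      then have "q (s *\<^sub>R x) \<le> p (s *\<^sub>R (x + t *\<^sub>R y)) - (s * t) * p y"
        using upper[of "s * t" "s *\<^sub>R x"] s by (simp add: algebra_simps)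
      also have "\<dots> = s * (p (x + t *\<^sub>R y) - t * p y)"
        using s by (simp add: sublinear_scaleR[OF p] right_diff_distrib mult.assoc)
      finally show "inverse s * q (s *\<^sub>R x) \<le> p (x + t *\<^sub>R y) - t * p y"
        using s by (simp add: field_simps)
    qed
    then show "q (s *\<^sub>R x) \<le> s * q x"
      using s by (simp add: field_simps)
  qed
qed

text \<open>Supplies the bounds for Zorn's lemma. Subadditivity survives because functionals
  \<open>q\<close> at \<open>x\<close> and \<open>r\<close> at \<open>y\<close> can be replaced by
  the smaller of the two, and \<open>p\<close> yields a common lower bound at each point.\<close>

lemma sublinear_INF_chain:
  fixes C :: "('a::real_vector \<Rightarrow> real) set"
  assumes ne: "C \<noteq> {}" and sub: "\<And>q. q \<in> C \<Longrightarrow> sublinear q"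
    and le: "\<And>q. q \<in> C \<Longrightarrow> q \<le> p"
    and chain: "\<And>q r. q \<in> C \<Longrightarrow> r \<in> C \<Longrightarrow> q \<le> r \<or> r \<le> q"
  shows "sublinear (\<lambda>x. INF q\<in>C. q x)" and "\<And>q x. q \<in> C \<Longrightarrow> (INF q\<in>C. q x) \<le> q x"
proof -
  let ?u = "\<lambda>x. INF q\<in>C. q x"
  have bdd: "bdd_below ((\<lambda>q. q x) ` C)" for x
  proof (rule bdd_belowI2)
    fix q assume "q \<in> C"
    then show "- p (- x) \<le> q x"
      using sublinear_ge_minus[OF sub, of q x] le_funD[OF le, of q "- x"] by linarith
  qed
  show upper: "?u x \<le> q x" if "q \<in> C" for q x
    using that by (intro cINF_lower bdd)
  show "sublinear ?u"
  proof (rule sublinearI)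
    fix x y
    have *: "?u (x + y) - r y \<le> q x" if q: "q \<in> C" and r: "r \<in> C" for q r
    proof -
      obtain w where w: "w \<in> C" "w \<le> q" "w \<le> r"
        using chain[OF q r] q r by blast
      have "?u (x + y) \<le> w x + w y"
        using upper[OF w(1), of "x + y"] sublinear_add[OF sub[OF w(1)], of x y] by linarith
      also have "\<dots> \<le> q x + r y"
        using w(2,3) by (intro add_mono) (auto simp: le_fun_def)
      finally show ?thesis by simp
    qed
    have "?u (x + y) - ?u x \<le> ?u y"
    proof (rule cINF_greatest[OF ne])
      fix r assume "r \<in> C"
      then have "?u (x + y) - r y \<le> ?u x"
        using ne by (intro cINF_greatest *)
      then show "?u (x + y) - ?u x \<le> r y" by simp
    qed
    then show "?u (x + y) \<le> ?u x + ?u y" by simp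
  next
    show "?u 0 = 0"
      using ne by (simp add: sublinear_0[OF sub] cong: INF_cong)
  next
    fix t :: real and x assume t: "0 < t"
    have "inverse t * ?u (t *\<^sub>R x) \<le> ?u x"
    proof (rule cINF_greatest[OF ne])
      fix q assume "q \<in> C"
      then show "inverse t * ?u (t *\<^sub>R x) \<le> q x"
        using upper[of q "t *\<^sub>R x"] t by (simp add: sublinear_scaleR[OF sub] field_simps)
    qed
    then show "?u (t *\<^sub>R x) \<le> t * ?u x"
      using t by (simp add: field_simps)
  qed
qed

text \<open>Lowering \<open>q\<close> in the direction \<open>- y\<close> gives a sublinear
  functional below \<open>q\<close>, hence \<open>q\<close> itself by minimality. The case
  \<open>t = 1\<close> of its bound is then superadditivity.\<close>

lemma minimal_sublinear_linear:
  fixes q :: "'a::real_vector \<Rightarrow> real"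
  assumes q: "sublinear q" and min: "\<And>r. sublinear r \<Longrightarrow> r \<le> q \<Longrightarrow> r = q"
  shows "linear q"
proof -
  have add: "q (x + y) = q x + q y" for x y
  proof -
    obtain r where r: "sublinear r" "\<And>x t. 0 \<le> t \<Longrightarrow> r x \<le> q (x + t *\<^sub>R y) - t * q y"
        using sublinear_lower[OF q, where y = y] by blast
    have "r = q"
      using r(2)[of 0] by (intro min r(1)) (auto simp: le_fun_def)
    then have "q x + q y \<le> q (x + y)"
      using r(2)[of 1 x] by simp
    with sublinear_add[OF q, of x y] show ?thesis by simp
  qed
  have minus: "q (- x) = - q x" for x
    using add[of x "- x"] sublinear_0[OF q] by simp
  have "q (t *\<^sub>R x) = t * q x" for t x
  proof (cases "0 \<le> t")
    case True
    then show ?thesis by (rule sublinear_scaleR[OF q])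
  next
    case False
    then show ?thesis
      using sublinear_scaleR[OF q, of "- t" x] minus[of "t *\<^sub>R x"] by simp
  qed
  then show ?thesis
    by (intro linearI) (simp_all add: add)
qed

lemma sublinear_minorant_linear:
  fixes p :: "'a::real_vector \<Rightarrow> real"
  assumes p: "sublinear p"
  obtains f where "linear f" "\<And>x. f x \<le> p x"
proof -
  define A where "A = {q. sublinear q \<and> q \<le> p}"
  \<comment> \<open>The order is reversed, so that the maximal element from Zorn's lemma is a
    minimal functional.\<close>
  define P where "P q r \<longleftrightarrow> r \<le> q" for q r :: "'a \<Rightarrow> real"
  have "\<exists>m\<in>A. \<forall>a\<in>A. P m a \<longrightarrow> a = m"
  proof (rule predicate_Zorn)
    show "partial_order_on A (relation_of P A)"
      by (rule partial_order_on_relation_ofI) (auto simp: P_def)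
  next
    fix C assume "C \<in> Chains (relation_of P A)"
    then have C: "C \<subseteq> A" and chain: "\<And>q r. q \<in> C \<Longrightarrow> r \<in> C \<Longrightarrow> q \<le> r \<or> r \<le> q"
      by (auto simp: Chains_def relation_of_def P_def)
    show "\<exists>u\<in>A. \<forall>a\<in>C. P a u"
    proof (cases "C = {}")
      case True
      then show ?thesis using p by (auto simp: A_def)
    next
      case False
      let ?u = "\<lambda>x. INF q\<in>C. q x"
      have le: "q \<le> p" if "q \<in> C" for q
        using that C by (auto simp: A_def)
      have sub: "sublinear q" if "q \<in> C" for q
        using that C by (auto simp: A_def)
      have u: "sublinear ?u" "q \<in> C \<Longrightarrow> ?u x \<le> q x" for q x
        by (rule sublinear_INF_chain[OF False sub le chain]; assumption)+
      obtain q where q: "q \<in> C" using False by blast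
      have "?u \<le> p"
        using order_trans[OF u(2)[OF q] le_funD[OF le[OF q]]] by (intro le_funI)
      with u show ?thesis
        by (intro bexI[of _ ?u]) (auto simp: A_def P_def le_fun_def)
    qed
  qed
  then obtain f where f: "sublinear f" "f \<le> p" "\<And>r. sublinear r \<Longrightarrow> r \<le> p \<Longrightarrow> r \<le> f \<Longrightarrow> r = f"
    by (auto simp: A_def P_def)
  \<comment> \<open>Minimality among the minorants of \<open>p\<close> is minimality outright, since
    whatever lies below \<open>f\<close> lies below \<open>p\<close>.\<close>
  have "linear f"
    using f by (intro minimal_sublinear_linear) (auto intro: order_trans)
  then show ?thesis
    using f(2) that by (auto simp: le_fun_def)
qed

text \<open>A form of the Hahn-Banach theorem. Choosing the linear minorant below the lowered
  functional \<open>q\<close> rather than below \<open>p\<close> forces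
  \<open>f (- y) \<le> - p y\<close>, which is the missing inequality at \<open>y\<close>.\<close>

lemma sublinear_support:
  fixes p :: "'a::real_vector \<Rightarrow> real"
  assumes p: "sublinear p"
  obtains f where "linear f" "\<And>x. f x \<le> p x" "f y = p y"
proof -
  obtain q where q: "sublinear q" "\<And>x t. 0 \<le> t \<Longrightarrow> q x \<le> p (x + t *\<^sub>R y) - t * p y"
    using sublinear_lower[OF p, where y = y] by blast
  obtain f where f: "linear f" "\<And>x. f x \<le> q x"
    using sublinear_minorant_linear[OF q(1)] by blast
  have le: "f x \<le> p x" for x
    using f(2)[of x] q(2)[of 0 x] by simp
  have "f (- y) \<le> - p y"
    using f(2)[of "- y"] q(2)[of 1 "- y"] sublinear_0[OF p] by simp
  then have "f y = p y"
    using le[of y] linear_neg[OF f(1), of y] by simp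
  with f(1) le show ?thesis by (rule that)
qed


section \<open>Gauges\<close>

text \<open>The Minkowski functional of \<open>W\<close>. The absorption hypothesis in the lemmas
  below keeps the set under \<open>Inf\<close> non-empty.\<close>

definition gauge_fun :: "'a::real_vector set \<Rightarrow> 'a \<Rightarrow> real"
  where "gauge_fun W z = Inf {t. 0 < t \<and> inverse t *\<^sub>R z \<in> W}"

lemma gauge_fun_le: "0 < t \<Longrightarrow> inverse t *\<^sub>R z \<in> W \<Longrightarrow> gauge_fun W z \<le> t"
  unfolding gauge_fun_def by (intro cInf_lower bdd_belowI[of _ 0]) auto

lemma gauge_fun_less_obtain:
  assumes absorbing: "\<And>z. \<exists>t>0. inverse t *\<^sub>R z \<in> W" and "gauge_fun W z < b"
  obtains t where "0 < t" "t < b" "inverse t *\<^sub>R z \<in> W"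
  using assms cInf_lessD[of "{t. 0 < t \<and> inverse t *\<^sub>R z \<in> W}" b]
  unfolding gauge_fun_def by blast

lemma sublinear_gauge_fun:
  fixes W :: "'a::real_vector set"
  assumes W: "convex W" "0 \<in> W" and absorbing: "\<And>z. \<exists>t>0. inverse t *\<^sub>R z \<in> W"
  shows "sublinear (gauge_fun W)"
proof -
  note less = gauge_fun_less_obtain[OF absorbing]
  have nonneg: "0 \<le> gauge_fun W z" for z
    using absorbing[of z] unfolding gauge_fun_def by (intro cInf_greatest) auto
  show ?thesis
  proof (rule sublinearI)
    fix x y
    show "gauge_fun W (x + y) \<le> gauge_fun W x + gauge_fun W y"
    proof (rule field_le_epsilon)
      fix e :: real assume "0 < e"
      then have "gauge_fun W x < gauge_fun W x + e/2" "gauge_fun W y < gauge_fun W y + e/2"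
        by simp_all
      then obtain s t where s: "0 < s" "s < gauge_fun W x + e/2" "inverse s *\<^sub>R x \<in> W"
        and t: "0 < t" "t < gauge_fun W y + e/2" "inverse t *\<^sub>R y \<in> W"
        using less by metis
      \<comment> \<open>The weights are chosen so that this convex combination is
        \<open>x + y\<close> scaled by \<open>inverse (s+t)\<close>.\<close>
      have "(s/(s+t)) *\<^sub>R (inverse s *\<^sub>R x) + (t/(s+t)) *\<^sub>R (inverse t *\<^sub>R y) \<in> W"
        using s t by (intro convexD[OF W(1)]) (simp_all flip: add_divide_distrib)
      moreover have "s/(s+t) * inverse s = inverse (s+t)" "t/(s+t) * inverse t = inverse (s+t)"
        using s(1) t(1) by (simp_all add: divide_simps)
      ultimately have "inverse (s+t) *\<^sub>R (x + y) \<in> W"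
        by (simp only: scaleR_scaleR scaleR_add_right)
      then show "gauge_fun W (x + y) \<le> gauge_fun W x + gauge_fun W y + e"
        using gauge_fun_le[of "s + t" "x + y" W] s t by simp
    qed
  next
    have "gauge_fun W 0 \<le> 0"
      by (rule field_le_epsilon) (use W gauge_fun_le[of _ 0 W] in auto)
    with nonneg[of 0] show "gauge_fun W 0 = 0" by simp
    fix t :: real and x assume t: "0 < t"
    show "gauge_fun W (t *\<^sub>R x) \<le> t * gauge_fun W x"
    proof (rule field_le_epsilon)
      fix e :: real assume "0 < e"
      then have "gauge_fun W x < gauge_fun W x + e/t"
        using t by simp
      then obtain s where s: "0 < s" "s < gauge_fun W x + e/t" "inverse s *\<^sub>R x \<in> W"
        using less by metis
      have "gauge_fun W (t *\<^sub>R x) \<le> t * s"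
        using s t by (intro gauge_fun_le) (simp_all add: field_simps)
      also have "\<dots> \<le> t * (gauge_fun W x + e/t)"
        using s t by simp
      finally show "gauge_fun W (t *\<^sub>R x) \<le> t * gauge_fun W x + e"
        using t by (simp add: algebra_simps)
    qed
  qed
qed

text \<open>A gauge below 1 would exhibit \<open>z\<close> as a convex combination of a point of
  \<open>W\<close> and 0.\<close>

lemma gauge_fun_ge_1:
  fixes W :: "'a::real_vector set"
  assumes W: "convex W" "0 \<in> W" and absorbing: "\<And>z. \<exists>t>0. inverse t *\<^sub>R z \<in> W"
    and z: "z \<notin> W"
  shows "1 \<le> gauge_fun W z"
proof (rule ccontr)
  assume "\<not> 1 \<le> gauge_fun W z"
  then obtain t where t: "0 < t" "t < 1" "inverse t *\<^sub>R z \<in> W"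
    using gauge_fun_less_obtain[OF absorbing, of z 1] by auto
  have "t *\<^sub>R (inverse t *\<^sub>R z) + (1 - t) *\<^sub>R 0 \<in> W"
    using t W by (intro convexD[OF W(1)]) auto
  with t z show False by simp
qed


section \<open>Topological vector spaces\<close>

lemma continuous_on_scaleR_tvs:
  fixes g :: "'b::topological_space \<Rightarrow> 'a::topological_real_vector"
  assumes f: "continuous_on S f" and g: "continuous_on S g"
  shows "continuous_on S (\<lambda>x. f x *\<^sub>R g x)"
  unfolding continuous_on_def
proof
  fix x assume "x \<in> S"
  then have "(f \<longlongrightarrow> f x) (at x within S)" "(g \<longlongrightarrow> g x) (at x within S)"
    using f g by (auto simp: continuous_on_def)
  then have "filterlim (\<lambda>y. (f y, g y)) (nhds (f x) \<times>\<^sub>F nhds (g x)) (at x within S)"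
    by (rule filterlim_Pair)
  from filterlim_compose[OF tendsto_scaleR_Pair this]
  show "((\<lambda>x. f x *\<^sub>R g x) \<longlongrightarrow> f x *\<^sub>R g x) (at x within S)" by simp
qed

lemma open_absorbing:
  fixes U :: "'a::topological_real_vector set"
  assumes "open U" "0 \<in> U"
  obtains e where "0 < e" "e *\<^sub>R z \<in> U"
proof -
  have "continuous_on UNIV (\<lambda>t::real. t *\<^sub>R z)"
    by (intro continuous_on_scaleR_tvs continuous_intros)
  then have "open ((\<lambda>t. t *\<^sub>R z) -` U)"
    using assms(1) by (rule open_vimage[rotated])
  moreover have "0 \<in> (\<lambda>t. t *\<^sub>R z) -` U"
    using assms(2) by simp
  \<comment> \<open>The ball is closed so that the scalar \<open>e\<close> itself belongs to
    it.\<close>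
  ultimately obtain e where e: "0 < e" "cball 0 e \<subseteq> (\<lambda>t. t *\<^sub>R z) -` U"
    using open_contains_cball by blast
  then have "e *\<^sub>R z \<in> U" by (auto simp: subset_iff)
  with e(1) show ?thesis by (rule that)
qed

text \<open>For fixed weights, the combination map is continuous and sends
  \<open>S \<times> S\<close> into \<open>S\<close>, hence the closure of the product into the
  closure of \<open>S\<close>.\<close>

lemma convex_closure_tvs:
  fixes S :: "'a::topological_real_vector set"
  assumes "convex S"
  shows "convex (closure S)"
proof (rule convexI)
  fix x y and u v :: real
  assume xy: "x \<in> closure S" "y \<in> closure S" and uv: "0 \<le> u" "0 \<le> v" "u + v = 1"
  let ?g = "\<lambda>z. u *\<^sub>R fst z + v *\<^sub>R snd z"
  have "continuous_on (closure (S \<times> S)) ?g"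
    by (intro continuous_on_add continuous_on_scaleR_tvs continuous_intros)
  moreover have "?g ` (S \<times> S) \<subseteq> closure S"
    using convexD[OF assms _ _ uv] closure_subset by fastforce
  ultimately have "?g ` closure (S \<times> S) \<subseteq> closure S"
    by (intro image_closure_subset) auto
  moreover have "(x, y) \<in> closure (S \<times> S)"
    using xy by (simp add: closure_Times)
  ultimately show "u *\<^sub>R x + v *\<^sub>R y \<in> closure S" by force
qed

text \<open>A one-sided bound suffices: it is applied to multiples of both \<open>y - z\<close> and
  \<open>z - y\<close>, which replaces symmetry of \<open>U\<close>.\<close>

lemma linear_continuous_of_bounded_nhd:
  fixes f :: "'a::topological_real_vector \<Rightarrow> real"
  assumes f: "linear f" and U: "open U" "0 \<in> U" and le: "\<And>v. v \<in> U \<Longrightarrow> f v \<le> 1"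
  shows "continuous_on UNIV f"
  unfolding continuous_on_def
proof (intro ballI tendstoI)
  fix z :: 'a and e :: real assume e: "0 < e"
  \<comment> \<open>With the factor 2 the two bounds give a distance of at most
    \<open>e / 2\<close>, hence strictly below \<open>e\<close>.\<close>
  define k where "k = 2 / e"
  have k: "0 < k" using e by (simp add: k_def)
  define N where "N = (\<lambda>y. k *\<^sub>R (y - z)) -` U \<inter> (\<lambda>y. k *\<^sub>R (z - y)) -` U"
  have "open N"
    unfolding N_def using U(1)
    by (intro open_Int open_vimage continuous_on_scaleR_tvs continuous_on_diff continuous_intros)
  moreover have "z \<in> N" using U(2) by (simp add: N_def)
  moreover have "dist (f y) (f z) < e" if "y \<in> N" for y
  proof -
    have "k * (f y - f z) \<le> 1" "k * (f z - f y) \<le> 1"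
      using that le[of "k *\<^sub>R (y - z)"] le[of "k *\<^sub>R (z - y)"]
      by (auto simp: N_def linear_scale[OF f] linear_diff[OF f])
    then show ?thesis
      using e by (auto simp: k_def dist_real_def abs_if field_simps)
  qed
  ultimately show "\<forall>\<^sub>F y in at z within UNIV. dist (f y) (f z) < e"
    unfolding eventually_at_topological by blast
qed

text \<open>The functional supports, at \<open>x - c\<close>, the gauge of a convex neighbourhood of
  0 that contains \<open>C - c\<close> but not \<open>x - c\<close>.\<close>

theorem separation_closed_convex_point:
  fixes C :: "'a::locally_convex_real_space set"
  assumes C: "closed C" "convex C" and x: "x \<notin> C"
  obtains f :: "'a \<Rightarrow> real" and a where "linear f" "continuous_on UNIV f" "\<And>y. y \<in> C \<Longrightarrow> f y < a" "a < f x"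
proof (cases "C = {}")
  \<comment> \<open>This case can arise below, where \<open>Omega h K\<close> is not known to be
    non-empty.\<close>
  case True
  show ?thesis
    by (rule that[of "\<lambda>_. 0" "- 1"]) (auto simp: True linear_zero)
next
  case False
  then obtain c where c: "c \<in> C" by blast
  have "open ((\<lambda>v. x - v) -` (- C))"
    using C(1) by (intro open_vimage continuous_on_diff continuous_intros) auto
  moreover have "0 \<in> (\<lambda>v. x - v) -` (- C)"
    using x by simp
  ultimately obtain U where U: "open U" "convex U" "0 \<in> U" "U \<subseteq> (\<lambda>v. x - v) -` (- C)"
    using convex_nhd_0 by blast
  \<comment> \<open>\<open>W\<close> is \<open>C - c + U\<close>. Adding \<open>U\<close> makes it
    absorbing, while \<open>x - c\<close> stays outside because \<open>x - v\<close> avoids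
    \<open>C\<close> for \<open>v\<close> in \<open>U\<close>.\<close>
  define W where "W = (\<Union>y\<in>(\<lambda>y. y - c) ` C. \<Union>v\<in>U. {y + v})"
  have W_I: "y - c + v \<in> W" if "y \<in> C" "v \<in> U" for y v
    using that unfolding W_def by blast
  have UW: "U \<subseteq> W"
    using W_I[OF c] by auto
  have W: "convex W"
    unfolding W_def by (intro convex_sums convex_translation_subtract C(2) U(2))
  have W0: "0 \<in> W"
    using UW U(3) by blast
  have absorbing: "\<exists>t>0. inverse t *\<^sub>R z \<in> W" for z
  proof -
    obtain e where "0 < e" "e *\<^sub>R z \<in> U" by (rule open_absorbing[OF U(1,3)])
    then show ?thesis
      using UW by (intro exI[of _ "inverse e"]) auto
  qed
  have "x - c \<notin> W"
  proof
    assume "x - c \<in> W"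
    then obtain y v where "y \<in> C" "v \<in> U" "x - c = y - c + v"
      unfolding W_def by blast
    then have "x - v \<in> C" by (simp add: algebra_simps)
    with U(4) \<open>v \<in> U\<close> show False by blast
  qed
  then have p1: "1 \<le> gauge_fun W (x - c)"
    by (rule gauge_fun_ge_1[OF W W0 absorbing])
  obtain f where f: "linear f" "\<And>z. f z \<le> gauge_fun W z" "f (x - c) = gauge_fun W (x - c)"
    using sublinear_support[OF sublinear_gauge_fun[OF W W0 absorbing]] by metis
  have le1: "f w \<le> 1" if "w \<in> W" for w
    using f(2)[of w] gauge_fun_le[of 1 w W] that by simp
  have cont: "continuous_on UNIV f"
    using le1 UW by (intro linear_continuous_of_bounded_nhd[OF f(1) U(1,3)]) auto
  \<comment> \<open>Strictness comes from the room left by \<open>U\<close>: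
    \<open>y - c + e *\<^sub>R (x - c)\<close> is still in \<open>W\<close>, so \<open>f y\<close>
    is at most \<open>f c + 1 - e\<close>, while \<open>f x\<close> is at least
    \<open>f c + 1\<close>. The threshold is put in between.\<close>
  obtain e where e: "0 < e" "e *\<^sub>R (x - c) \<in> U"
    by (rule open_absorbing[OF U(1,3)])
  have "f y < f c + 1 - e/2" if "y \<in> C" for y
  proof -
    have "f y - f c + e * f (x - c) \<le> 1"
      using le1[OF W_I[OF that e(2)]] by (simp add: linear_add[OF f(1)] linear_diff[OF f(1)] linear_scale[OF f(1)])
    moreover have "e * 1 \<le> e * f (x - c)"
      using p1 f(3) e(1) by (intro mult_left_mono) auto
    ultimately show ?thesis using e(1) by linarith
  qed
  moreover have "f c + 1 - e/2 < f x"
    using p1 f(3) e(1) linear_diff[OF f(1), of x c] by simp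
  ultimately show ?thesis
    using that f(1) cont by blast
qed


section \<open>Affine minorants and approximating minimizers\<close>

lemma affine_funD:
  "affine_fun m \<Longrightarrow> u + v = 1 \<Longrightarrow> m (u *\<^sub>R x + v *\<^sub>R y) = u * m x + v * m y"
  by (simp add: affine_fun_def)

lemma affine_continuous_const: "(\<lambda>_. c) \<in> affine_continuous"
  by (simp add: affine_continuous_def affine_fun_def flip: distrib_right)

lemma affine_continuous_linear:
  assumes "linear f" "continuous_on UNIV f"
  shows "(\<lambda>y. c + e * (f y - a)) \<in> affine_continuous"
proof -
  have "affine_fun (\<lambda>y. c + e * (f y - a))"
    unfolding affine_fun_def
  proof (intro allI impI)
    fix x y and u v :: real assume "u + v = 1"
    then have v: "v = 1 - u" by simp
    show "c + e * (f (u *\<^sub>R x + v *\<^sub>R y) - a) = u * (c + e * (f x - a)) + v * (c + e * (f y - a))"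
      unfolding linear_add[OF assms(1)] linear_scale[OF assms(1)] v by (simp add: algebra_simps)
  qed
  moreover have "continuous_on UNIV (\<lambda>y. c + e * (f y - a))"
    using assms(2) by (intro continuous_intros)
  ultimately show ?thesis by (simp add: affine_continuous_def)
qed

section \<open>Infimum and minimizers of the \<Gamma>-regularization\<close>

lemma Gamma_reg_ge:
  "m \<in> affine_continuous \<Longrightarrow> (\<And>y. y \<in> K \<Longrightarrow> ereal (m y) \<le> h y) \<Longrightarrow> ereal (m x) \<le> Gamma_reg K h x"
  unfolding Gamma_reg_def by (rule SUP_upper) auto

lemma Gamma_reg_le_iff:
  "Gamma_reg K h x \<le> c \<longleftrightarrow>
    (\<forall>m\<in>affine_continuous. (\<forall>y\<in>K. ereal (m y) \<le> h y) \<longrightarrow> ereal (m x) \<le> c)"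
  unfolding Gamma_reg_def SUP_le_iff by auto

lemma INF_Gamma_reg: "(INF x\<in>K. Gamma_reg K h x) = (INF x\<in>K. h x)"
proof (rule antisym)
  show "(INF x\<in>K. Gamma_reg K h x) \<le> (INF x\<in>K. h x)"
    by (rule INF_mono) (auto simp: Gamma_reg_le_iff)
  have "(INF x\<in>K. h x) \<le> Gamma_reg K h y" for y
  proof (rule ccontr)
    assume "\<not> (INF x\<in>K. h x) \<le> Gamma_reg K h y"
    then have "Gamma_reg K h y < (INF x\<in>K. h x)"
      by simp
    \<comment> \<open>The infimum may be infinite and so not the value of a real constant; a real
      \<open>z\<close> below it is an admissible constant minorant.\<close>
    then obtain z where z: "Gamma_reg K h y < ereal z" "ereal z < (INF x\<in>K. h x)"
      using ereal_dense2 by blast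
    have "ereal z \<le> Gamma_reg K h y"
      by (rule Gamma_reg_ge[OF affine_continuous_const])
        (use z(2) in \<open>auto dest: less_INF_D less_imp_le\<close>)
    with z(1) show False by simp
  qed
  then show "(INF x\<in>K. h x) \<le> (INF x\<in>K. Gamma_reg K h x)"
    by (rule INF_greatest)
qed

text \<open>Turns the minimizers into a sublevel set, which can be handled through the affine
  minorants one by one.\<close>

lemma minimizers_Gamma_reg:
  "minimizers (Gamma_reg K h) K = {x \<in> K. Gamma_reg K h x \<le> (INF y\<in>K. h y)}"
  unfolding INF_Gamma_reg[of K h, symmetric] minimizers_def by (auto simp: le_INF_iff)

text \<open>Here \<open>h\<close> is constantly infinite on \<open>K\<close>, so every point
  approximates itself.\<close>

lemma Omega_eq_if_INF_infinite:
  assumes "(INF y\<in>K. h y) = \<infinity>"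
  shows "Omega h K = K"
proof
  show "Omega h K \<subseteq> K"
    by (auto simp: Omega_def)
  show "K \<subseteq> Omega h K"
  proof
    fix x assume x: "x \<in> K"
    then have "h x = (INF y\<in>K. h y)"
      using INF_lower[OF x, of h] assms by simp
    with x show "x \<in> Omega h K"
      unfolding Omega_iff_dense by (metis (full_types))
  qed
qed

text \<open>The sublevel set is the intersection of \<open>K\<close> with the sets where
  \<open>m \<le> c\<close>, one for each admissible minorant \<open>m\<close>; closedness below has
  the same reason.\<close>

lemma convex_Gamma_reg_sublevel:
  assumes "convex K"
  shows "convex {x \<in> K. Gamma_reg K h x \<le> ereal c}"
proof (rule convexI)
  fix x y and u v :: real
  assume xy: "x \<in> {x \<in> K. Gamma_reg K h x \<le> ereal c}" "y \<in> {x \<in> K. Gamma_reg K h x \<le> ereal c}"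
    and uv: "0 \<le> u" "0 \<le> v" "u + v = 1"
  have "m (u *\<^sub>R x + v *\<^sub>R y) \<le> c"
    if m: "m \<in> affine_continuous" "\<forall>y\<in>K. ereal (m y) \<le> h y" for m
  proof -
    have "m x \<le> c" "m y \<le> c"
      using xy m by (auto simp: Gamma_reg_le_iff)
    then have "u * m x + v * m y \<le> c"
      using uv by (rule convex_bound_le)
    then show ?thesis
      using m(1) uv(3) by (simp add: affine_continuous_def affine_funD)
  qed
  then show "u *\<^sub>R x + v *\<^sub>R y \<in> {x \<in> K. Gamma_reg K h x \<le> ereal c}"
    using xy convexD[OF assms _ _ uv] by (auto simp: Gamma_reg_le_iff)
qed

lemma closed_Gamma_reg_sublevel:
  assumes "closed K"
  shows "closed {x \<in> K. Gamma_reg K h x \<le> ereal c}"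
proof -
  let ?A = "{m \<in> affine_continuous. \<forall>y\<in>K. ereal (m y) \<le> h y}"
  have "{x \<in> K. Gamma_reg K h x \<le> ereal c} = K \<inter> (\<Inter>m\<in>?A. {x. m x \<le> c})"
    by (auto simp: Gamma_reg_le_iff)
  moreover have "closed {x. m x \<le> c}" if "m \<in> ?A" for m
    using that by (intro closed_Collect_le) (auto simp: affine_continuous_def)
  ultimately show ?thesis
    using assms by (auto intro!: closed_Int closed_INT)
qed

lemma Gamma_reg_le_on_Omega:
  assumes c: "(INF y\<in>K. h y) = ereal c" and x: "x \<in> Omega h K"
  shows "Gamma_reg K h x \<le> ereal c"
  unfolding Gamma_reg_le_iff
proof (intro ballI impI)
  fix m assume m: "m \<in> affine_continuous" "\<forall>y\<in>K. ereal (m y) \<le> h y"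
  show "ereal (m x) \<le> ereal c"
  proof (rule ccontr)
    assume "\<not> ereal (m x) \<le> ereal c"
    \<comment> \<open>By continuity \<open>m\<close> stays above \<open>b\<close> near
      \<open>x\<close>, whereas \<open>h\<close> takes values below \<open>b\<close> there,
      contradicting \<open>m \<le> h\<close>.\<close>
    then obtain b where b: "c < b" "b < m x"
      using dense[of c "m x"] by auto
    have "open {y. b < m y}"
      using m(1) by (intro open_Collect_less) (auto simp: affine_continuous_def)
    moreover have "x \<in> {y. b < m y}" "open {..<ereal b}" "(INF y\<in>K. h y) \<in> {..<ereal b}"
      using b c by auto
    ultimately obtain y where y: "y \<in> K" "b < m y" "h y < ereal b"
      using x unfolding Omega_iff_dense by blast
    with m(2) have "ereal (m y) < ereal b"
      using order.strict_trans1 by blast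
    with y(2) show False by simp
  qed
qed

text \<open>Near such a point \<open>h\<close> avoids a whole interval around \<open>c\<close>; as
  \<open>h\<close> never drops below \<open>c\<close> on \<open>K\<close>, it must lie beyond the
  upper end.\<close>

lemma not_Omega_obtain:
  assumes c: "(INF y\<in>K. h y) = ereal c" and x: "x \<in> K" "x \<notin> Omega h K"
  obtains U b where "open U" "x \<in> U" "c < b" "\<And>y. y \<in> K \<Longrightarrow> y \<in> U \<Longrightarrow> ereal b \<le> h y"
proof -
  obtain U V where UV: "open U" "x \<in> U" "open V" "ereal c \<in> V" "\<And>y. y \<in> K \<Longrightarrow> y \<in> U \<Longrightarrow> h y \<notin> V"
    using x unfolding Omega_iff_dense c by blast
  obtain a b where ab: "a < ereal c" "ereal c < b" "{a<..<b} \<subseteq> V"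
    using ereal_open_cont_interval2[OF UV(3,4)] by auto
  \<comment> \<open>The end point \<open>b\<close> is extended real and may be infinite; a real
    bound is required.\<close>
  obtain b' where b': "ereal c < ereal b'" "ereal b' < b"
    using ereal_dense2[OF ab(2)] by blast
  have "ereal b' \<le> h y" if y: "y \<in> K" "y \<in> U" for y
  proof -
    have "ereal c \<le> h y"
      using INF_lower[OF y(1), of h] c by simp
    then have "a < h y"
      using ab(1) by (rule order.strict_trans2[rotated])
    then have "\<not> h y < b"
      using UV(5)[OF y] ab(3) by auto
    with b'(2) show ?thesis by simp
  qed
  then show ?thesis
    using that[OF UV(1,2), of b'] b'(1) by simp
qed

lemma compact_avoiding_Omega_bound:
  assumes c: "(INF y\<in>K. h y) = ereal c"
    and L: "compact L" "L \<subseteq> K" "L \<inter> Omega h K = {}"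
  obtains b where "c < b" "\<And>y. y \<in> L \<Longrightarrow> ereal b \<le> h y"
proof -
  have "\<forall>x\<in>L. \<exists>U b. open U \<and> x \<in> U \<and> c < b \<and> (\<forall>y\<in>K. y \<in> U \<longrightarrow> ereal b \<le> h y)"
  proof
    fix x assume "x \<in> L"
    then have "x \<in> K" "x \<notin> Omega h K" using L by auto
    then show "\<exists>U b. open U \<and> x \<in> U \<and> c < b \<and> (\<forall>y\<in>K. y \<in> U \<longrightarrow> ereal b \<le> h y)"
      using not_Omega_obtain[OF c] by metis
  qed
  then obtain U b where Ub: "\<And>x. x \<in> L \<Longrightarrow> open (U x) \<and> x \<in> U x \<and> c < b x"
    "\<And>x y. x \<in> L \<Longrightarrow> y \<in> K \<Longrightarrow> y \<in> U x \<Longrightarrow> ereal (b x) \<le> h y"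
    by metis
  obtain D where D: "D \<subseteq> L" "finite D" "L \<subseteq> (\<Union>x\<in>D. U x)"
    by (rule compactE_image[OF L(1), of L U]) (use Ub(1) in auto)
  \<comment> \<open>The value \<open>c + 1\<close> keeps the set non-empty when \<open>L\<close>,
    and with it possibly \<open>D\<close>, is empty.\<close>
  let ?b = "Min (insert (c + 1) (b ` D))"
  have "c < ?b"
    using D(1,2) Ub(1) by auto
  moreover have "ereal ?b \<le> h y" if y: "y \<in> L" for y
  proof -
    obtain x where x: "x \<in> D" "y \<in> U x" using D(3) y by blast
    then have "?b \<le> b x" using D(2) by (intro Min_le) auto
    then have "ereal ?b \<le> ereal (b x)" by simp
    also have "\<dots> \<le> h y" using x D(1) y L(2) by (intro Ub(2)) auto
    finally show ?thesis .
  qed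
  ultimately show ?thesis by (rule that)
qed

lemma Gamma_reg_gt_off_hull:
  fixes K :: "'a::locally_convex_real_space set"
  assumes K: "compact K" and c: "(INF y\<in>K. h y) = ereal c"
    and x: "x \<notin> closure (convex hull (Omega h K))"
  shows "ereal c < Gamma_reg K h x"
proof -
  have "convex (closure (convex hull (Omega h K)))"
    by (intro convex_closure_tvs convex_convex_hull)
  then obtain f :: "'a \<Rightarrow> real" and a where f: "linear f" "continuous_on UNIV f"
    and fa: "\<And>y. y \<in> closure (convex hull (Omega h K)) \<Longrightarrow> f y < a" "a < f x"
    using separation_closed_convex_point[OF closed_closure _ x] by metis
  have fOmega: "f y < a" if "y \<in> Omega h K" for y
    using that hull_subset[of "Omega h K" convex] closure_subset by (intro fa(1)) blast
  define L where "L = K \<inter> {y. a \<le> f y}"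
  have "closed {y. a \<le> f y}"
    using f(2) by (intro closed_Collect_le) auto
  then have "compact L"
    unfolding L_def using K by (rule compact_Int_closed[rotated])
  moreover have "L \<subseteq> K" "L \<inter> Omega h K = {}"
    using fOmega by (force simp: L_def)+
  ultimately obtain b where b: "c < b" "\<And>y. y \<in> L \<Longrightarrow> ereal b \<le> h y"
    using compact_avoiding_Omega_bound[OF c] by metis
  have "compact (f ` K)"
    using f(2) K by (intro compact_continuous_image) (auto intro: continuous_on_subset)
  then have "bdd_above (f ` K)"
    by (intro bounded_imp_bdd_above compact_imp_bounded)
  then obtain B where B: "\<And>y. y \<in> K \<Longrightarrow> f y \<le> B"
    by (auto simp: bdd_above_def)
  \<comment> \<open>The slope must keep the minorant at most \<open>b\<close> on \<open>L\<close>,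
    that is \<open>e * (B - a) \<le> b - c\<close>. The denominator exceeds \<open>B - a\<close> and
    is positive whatever the sign of \<open>B - a\<close>.\<close>
  define e where "e = (b - c) / (\<bar>B - a\<bar> + 1)"
  have e: "0 < e" using b(1) by (simp add: e_def)
  have eB: "e * (B - a) \<le> b - c"
  proof -
    have "e * (B - a) \<le> e * (\<bar>B - a\<bar> + 1)"
      using e by (intro mult_left_mono) auto
    then show ?thesis by (simp add: e_def)
  qed
  let ?m = "\<lambda>y. c + e * (f y - a)"
  have "ereal (?m y) \<le> h y" if y: "y \<in> K" for y
  proof (cases "a \<le> f y")
    case True
    have "e * (f y - a) \<le> e * (B - a)"
      using e B[OF y] by (intro mult_left_mono) auto
    with eB have "ereal (?m y) \<le> ereal b" by simp
    also have "\<dots> \<le> h y" using True y by (intro b(2)) (simp add: L_def)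
    finally show ?thesis .
  next
    case False
    then have "ereal (?m y) \<le> ereal c"
      using e by (simp add: mult_le_0_iff)
    also have "\<dots> \<le> h y" using INF_lower[OF y, of h] c by simp
    finally show ?thesis .
  qed
  then have "ereal (?m x) \<le> Gamma_reg K h x"
    by (rule Gamma_reg_ge[OF affine_continuous_linear[OF f]])
  moreover have "ereal c < ereal (?m x)"
    using e fa(2) by simp
  ultimately show ?thesis by (rule order.strict_trans2[rotated])
qed

theorem theorem1p4:
  fixes K :: "'a::locally_convex_real_space set" and h :: "'a \<Rightarrow> ereal" and k :: real
  assumes "K \<noteq> {}" and "compact K" and "convex K"
    and "\<And>x. x \<in> K \<Longrightarrow> ereal k \<le> h x"
  shows "(INF x\<in>K. h x) = (INF x\<in>K. Gamma_reg K h x) \<and>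
    minimizers (Gamma_reg K h) K = closure (convex hull (Omega h K))"
proof
  show "(INF x\<in>K. h x) = (INF x\<in>K. Gamma_reg K h x)"
    by (simp add: INF_Gamma_reg)
  have closed: "closed K"
    using assms(2) by (rule compact_imp_closed)
  have Omega_K: "Omega h K \<subseteq> K"
    by (auto simp: Omega_def)
  have "ereal k \<le> (INF x\<in>K. h x)"
    using assms(4) by (rule INF_greatest)
  \<comment> \<open>The lower bound \<open>k\<close> excludes the value minus infinity.\<close>
  then consider (real) c where "(INF x\<in>K. h x) = ereal c" | (infinite) "(INF x\<in>K. h x) = \<infinity>"
    by (cases "INF x\<in>K. h x") auto
  then show "minimizers (Gamma_reg K h) K = closure (convex hull (Omega h K))"
  proof cases
    \<comment> \<open>Both sides are \<open>K\<close>: the sublevel condition is vacuous, and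
      \<open>Omega h K = K\<close> is already closed and convex.\<close>
    case infinite
    then show ?thesis
      using assms(3) closed
      by (simp add: minimizers_Gamma_reg Omega_eq_if_INF_infinite hull_same closure_closed)
  next
    case (real c)
    let ?M = "{x \<in> K. Gamma_reg K h x \<le> ereal c}"
    have "closure (convex hull (Omega h K)) \<subseteq> ?M"
      using Omega_K Gamma_reg_le_on_Omega[OF real] assms(3) closed
      by (intro closure_minimal hull_minimal convex_Gamma_reg_sublevel closed_Gamma_reg_sublevel)
        auto
    moreover have "?M \<subseteq> closure (convex hull (Omega h K))"
      using Gamma_reg_gt_off_hull[OF assms(2) real] by (force simp: not_less[symmetric])
    ultimately show ?thesis
      by (simp add: minimizers_Gamma_reg real)
  qed
qed

end
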